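(* Let $G$ be a group with finite generating set $S$. Let $g\in G$ be a strict dead-end element of depth $k\geq 1$ (that is, a dead-end element with strict depth $k$). Then $\kappa_r^{\mathcal S}(g)\geq 0$ for all $r<k$.
   Context: Let $|x|$ denote the word length of $x\in G$ in the word metric of $(G,S)$, and $d(x,y)=|x^{-1}y|$. For a radius $r$ (a non-negative integer) let $S_r=\{w\in G : |w|=r\}$ be the sphere of radius $r$ about the identity $e$. The (spherical) comparison curvature of radius $r$ of $g$ is $$\kappa_r^{\mathcal S}(g)=\frac{|g|-\frac{1}{|S_r|}\sum_{w\in S_r}d(w,gw)}{|g|},\qquad d(w,gw)=|w^{-1}gw|.$$ A dead-end element of $(G,S)$ is an element $g\in G$ such that no geodesic from the identity to $g$ can be extended past $g$. Such a $g$ has strict depth $k$ if $|g|>|ga_1|>|ga_1a_2|>\dots>|ga_1a_2\cdots a_k|$ for any $a_1,\dots,a_k\in S$.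
   Formalization: Strict depth k is required only along geodesic words a_1...a_m, m at most k, in letters of S and their inverses; read literally with S symmetric, taking a_2 as the inverse of a_1 gives |g|>|ga_1|>|g|, so no element has strict depth k for k at least 2. *)

theory Defs
  imports Complex_Main "HOL-Algebra.Generated_Groups"
begin

text \<open>
  The word metric of \<open>(G, S)\<close> uses the letters \<open>S \<union> S\<inverse>\<close>, so \<open>S\<close> is not required to be symmetric.
\<close>

definition letters :: "('a, 'b) monoid_scheme \<Rightarrow> 'a set \<Rightarrow> 'a set" where
  "letters G S = S \<union> m_inv G ` S"

definition word_prod :: "('a, 'b) monoid_scheme \<Rightarrow> 'a list \<Rightarrow> 'a" where
  "word_prod G as = foldr (\<otimes>\<^bsub>G\<^esub>) as \<one>\<^bsub>G\<^esub>"

definition word_length :: "('a, 'b) monoid_scheme \<Rightarrow> 'a set \<Rightarrow> 'a \<Rightarrow> nat" where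
  "word_length G S x =
     (LEAST n. \<exists>as \<in> lists (letters G S). length as = n \<and> word_prod G as = x)"

definition word_dist :: "('a, 'b) monoid_scheme \<Rightarrow> 'a set \<Rightarrow> 'a \<Rightarrow> 'a \<Rightarrow> nat" where
  "word_dist G S x y = word_length G S (inv\<^bsub>G\<^esub> x \<otimes>\<^bsub>G\<^esub> y)"

definition word_sphere :: "('a, 'b) monoid_scheme \<Rightarrow> 'a set \<Rightarrow> nat \<Rightarrow> 'a set" where
  "word_sphere G S r = {w \<in> carrier G. word_length G S w = r}"

text \<open>
  With \<open>x / 0 = 0\<close>, the value for \<open>|g| = 0\<close> is \<open>0\<close>, and an empty sphere (possible only when the
  group is finite) contributes the average \<open>0\<close>.
\<close>

definition spherical_curvature :: "('a, 'b) monoid_scheme \<Rightarrow> 'a set \<Rightarrow> nat \<Rightarrow> 'a \<Rightarrow> real" where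
  "spherical_curvature G S r g =
     (real (word_length G S g)
        - (1 / real (card (word_sphere G S r)))
            * (\<Sum>w \<in> word_sphere G S r. real (word_dist G S w (g \<otimes>\<^bsub>G\<^esub> w))))
     / real (word_length G S g)"

text \<open>A geodesic path in the Cayley graph starting at the identity, given by its edge labels.\<close>

definition geodesic_word :: "('a, 'b) monoid_scheme \<Rightarrow> 'a set \<Rightarrow> 'a list \<Rightarrow> bool" where
  "geodesic_word G S as \<longleftrightarrow>
     as \<in> lists (letters G S) \<and> word_length G S (word_prod G as) = length as"

definition dead_end :: "('a, 'b) monoid_scheme \<Rightarrow> 'a set \<Rightarrow> 'a \<Rightarrow> bool" where
  "dead_end G S g \<longleftrightarrow>
     g \<in> carrier G \<and>
     (\<forall>as. geodesic_word G S as \<and> word_prod G as = g \<longrightarrow>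
        \<not> (\<exists>s \<in> letters G S. geodesic_word G S (as @ [s])))"

text \<open>
  Strict depth \<open>k\<close> means \<open>|g| > |g a\<^sub>1| > \<dots> > |g a\<^sub>1 \<dots> a\<^sub>k|\<close> for any letters \<open>a\<^sub>1, \<dots>, a\<^sub>k\<close>.
  The words \<open>a\<^sub>1 \<dots> a\<^sub>k\<close> have to be read as geodesic ones: a word that backtracks, such as
  \<open>a a\<inverse>\<close>, returns to \<open>g\<close>, so no element could have strict depth \<open>k \<ge> 2\<close> if all words over
  \<open>S \<union> S\<inverse>\<close> were admitted (unless \<open>S\<close> is empty).
  Geodesic words of length less than \<open>k\<close> are included because they need not extend to geodesic
  words of length \<open>k\<close>; there may even be none of length \<open>k\<close>, when the group is finite.
\<close>

definition strict_depth :: "('a, 'b) monoid_scheme \<Rightarrow> 'a set \<Rightarrow> 'a \<Rightarrow> nat \<Rightarrow> bool" where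
  "strict_depth G S g k \<longleftrightarrow>
     (\<forall>as. geodesic_word G S as \<and> length as \<le> k \<longrightarrow>
        (\<forall>i < length as.
           word_length G S (g \<otimes>\<^bsub>G\<^esub> word_prod G (take i as))
             > word_length G S (g \<otimes>\<^bsub>G\<^esub> word_prod G (take (Suc i) as))))"

end

(* Strict depth makes |g w| <= |g| - |w| along a geodesic for w, so the path from w to g w
   obtained by first undoing w has length at most |w| + (|g| - |w|) = |g|. Hence no term of the
   spherical average exceeds |g|. *)
theory Submission
  imports Defs
begin

context group
begin

lemma letters_closed: "S \<subseteq> carrier G \<Longrightarrow> letters G S \<subseteq> carrier G"
  by (auto simp: letters_def)

lemma inv_in_letters: "S \<subseteq> carrier G \<Longrightarrow> a \<in> letters G S \<Longrightarrow> inv a \<in> letters G S"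
  by (auto simp: letters_def subset_iff)

lemma word_prod_closed: "as \<in> lists (carrier G) \<Longrightarrow> word_prod G as \<in> carrier G"
  by (induction as) (auto simp: word_prod_def)

lemma word_prod_append:
  assumes "as \<in> lists (carrier G)" "bs \<in> lists (carrier G)"
  shows "word_prod G (as @ bs) = word_prod G as \<otimes> word_prod G bs"
  using assms(1)
proof (induction as rule: lists.induct)
  case Nil
  then show ?case using word_prod_closed[OF assms(2)] by (simp add: word_prod_def)
next
  case (Cons a as)
  then show ?case
    using word_prod_closed[of as] word_prod_closed[OF assms(2)]
    by (simp add: word_prod_def m_assoc)
qed

lemma word_prod_inv:
  assumes "as \<in> lists (carrier G)"
  shows "word_prod G (rev (map (m_inv G) as)) = inv (word_prod G as)"
  using assms
proof (induction as rule: lists.induct)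
  case Nil
  then show ?case by (simp add: word_prod_def)
next
  case (Cons a as)
  have closed: "a \<in> carrier G" "as \<in> lists (carrier G)"
    using Cons.hyps by auto
  then have "rev (map (m_inv G) as) \<in> lists (carrier G)" by auto
  then have "word_prod G (rev (map (m_inv G) as) @ [inv a])
      = word_prod G (rev (map (m_inv G) as)) \<otimes> word_prod G [inv a]"
    using closed by (intro word_prod_append) auto
  also have "\<dots> = inv (word_prod G as) \<otimes> inv a"
    using Cons.IH closed by (simp add: word_prod_def)
  also have "\<dots> = inv (word_prod G (a # as))"
    using closed word_prod_closed[of as] by (simp add: word_prod_def inv_mult_group)
  finally show ?case by simp
qed

lemma word_length_le:
  assumes "as \<in> lists (letters G S)"
  shows "word_length G S (word_prod G as) \<le> length as"
  unfolding word_length_def using assms by (intro Least_le) auto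

lemma generate_word:
  assumes "S \<subseteq> carrier G" "x \<in> generate G S"
  shows "\<exists>as \<in> lists (letters G S). word_prod G as = x"
  using assms(2)
proof (induction x rule: generate.induct)
  case one
  then show ?case by (intro bexI[of _ "[]"]) (auto simp: word_prod_def)
next
  case (incl h)
  then show ?case
    using assms(1) by (intro bexI[of _ "[h]"]) (auto simp: word_prod_def letters_def)
next
  case (inv h)
  then show ?case
    using assms(1) by (intro bexI[of _ "[inv h]"]) (auto simp: word_prod_def letters_def)
next
  case (eng h1 h2)
  then obtain as bs where
      ab: "as \<in> lists (letters G S)" "bs \<in> lists (letters G S)"
      and "word_prod G as = h1" "word_prod G bs = h2"
    by blast
  moreover have "as \<in> lists (carrier G)" "bs \<in> lists (carrier G)"
    using ab letters_closed[OF assms(1)] by auto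
  ultimately show ?case
    using word_prod_append by (intro bexI[of _ "as @ bs"]) auto
qed

lemma geodesic_word_exists:
  assumes "S \<subseteq> carrier G" "x \<in> generate G S"
  obtains as where "geodesic_word G S as" "word_prod G as = x"
proof -
  obtain bs where "bs \<in> lists (letters G S)" "word_prod G bs = x"
    using generate_word[OF assms] by blast
  then have "\<exists>n. \<exists>as \<in> lists (letters G S). length as = n \<and> word_prod G as = x" by blast
  from LeastI_ex[OF this] obtain as where
      "as \<in> lists (letters G S)" "length as = word_length G S x" "word_prod G as = x"
    unfolding word_length_def by blast
  then show thesis by (intro that) (simp_all add: geodesic_word_def)
qed

lemma word_length_inv_mult_le:
  assumes S: "S \<subseteq> carrier G" and x: "x \<in> generate G S" and y: "y \<in> generate G S"
  shows "word_length G S (inv x \<otimes> y) \<le> word_length G S x + word_length G S y"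
proof -
  obtain as where as: "geodesic_word G S as" "word_prod G as = x"
    using geodesic_word_exists[OF S x] .
  obtain bs where bs: "geodesic_word G S bs" "word_prod G bs = y"
    using geodesic_word_exists[OF S y] .
  let ?as' = "rev (map (m_inv G) as)"
  have letters: "?as' \<in> lists (letters G S)" "bs \<in> lists (letters G S)"
    using as bs inv_in_letters[OF S] by (auto simp: geodesic_word_def)
  have carrier: "as \<in> lists (carrier G)" "?as' \<in> lists (carrier G)" "bs \<in> lists (carrier G)"
    using as letters letters_closed[OF S] by (auto simp: geodesic_word_def)
  have "word_prod G (?as' @ bs) = inv x \<otimes> y"
    using carrier word_prod_append word_prod_inv as(2) bs(2) by simp
  then show ?thesis
    using word_length_le[of "?as' @ bs" S] letters as bs by (simp add: geodesic_word_def)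
qed

lemma strict_depth_descent:
  assumes "strict_depth G S g k" "g \<in> carrier G" "geodesic_word G S as"
    and "length as \<le> k" "i \<le> length as"
  shows "word_length G S (g \<otimes> word_prod G (take i as)) + i \<le> word_length G S g"
  using assms(5)
proof (induction i)
  case 0
  then show ?case using assms(2) by (simp add: word_prod_def)
next
  case (Suc i)
  then have "word_length G S (g \<otimes> word_prod G (take (Suc i) as))
      < word_length G S (g \<otimes> word_prod G (take i as))"
    using assms by (simp add: strict_depth_def)
  with Suc show ?case by simp
qed

lemma word_dist_le_of_strict_depth:
  assumes S: "S \<subseteq> carrier G" "generate G S = carrier G"
    and g: "g \<in> carrier G" "strict_depth G S g k"
    and w: "w \<in> carrier G" "word_length G S w \<le> k"
  shows "word_dist G S w (g \<otimes> w) \<le> word_length G S g"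
proof -
  obtain as where as: "geodesic_word G S as" "word_prod G as = w"
    using geodesic_word_exists[of S w] S w by auto
  then have len: "length as = word_length G S w" by (simp add: geodesic_word_def)
  have "word_length G S (g \<otimes> w) + word_length G S w \<le> word_length G S g"
    using strict_depth_descent[OF g(2,1) as(1), of "length as"] as len w by simp
  moreover have "word_dist G S w (g \<otimes> w) \<le> word_length G S w + word_length G S (g \<otimes> w)"
    unfolding word_dist_def using S g w by (intro word_length_inv_mult_le) auto
  ultimately show ?thesis by simp
qed

end

lemma spherical_curvature_nonneg:
  fixes G (structure)
  assumes "\<And>w. w \<in> word_sphere G S r \<Longrightarrow> word_dist G S w (g \<otimes> w) \<le> word_length G S g"
  shows "0 \<le> spherical_curvature G S r g"
proof -
  let ?A = "word_sphere G S r" and ?l = "real (word_length G S g)"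
  have "(\<Sum>w\<in>?A. real (word_dist G S w (g \<otimes> w))) \<le> real (card ?A) * ?l"
    using assms by (intro sum_bounded_above) simp
  then have "1 / real (card ?A) * (\<Sum>w\<in>?A. real (word_dist G S w (g \<otimes> w))) \<le> ?l"
    by (cases "card ?A = 0") (simp_all add: field_simps)
  then show ?thesis by (simp add: spherical_curvature_def)
qed

theorem proposition1p3:
  fixes G (structure) and S :: "'a set" and g :: 'a and k :: nat
  assumes "group G"
    and "S \<subseteq> carrier G" and "finite S" and "generate G S = carrier G"
    and "g \<in> carrier G"
    and "k \<ge> 1"
    and "dead_end G S g" and "strict_depth G S g k"
  shows "\<forall>r < k. spherical_curvature G S r g \<ge> 0"
proof (intro allI impI)
  fix r assume "r < k"
  then show "0 \<le> spherical_curvature G S r g"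
    using assms
    by (intro spherical_curvature_nonneg group.word_dist_le_of_strict_depth[where k = k])
      (auto simp: word_sphere_def)
qed

end
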